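(* The category $\mathbf{QMA}$ of quantum monadic algebras and their homomorphisms is isomorphic to the category $\mathbf{MQIA}$ of monadic quasi-implication algebras and their homomorphisms.
   Context: An ortholattice is a bounded lattice $\langle A;\wedge,\vee,0,1\rangle$ with a unary operation $^{\perp}$ such that $x\wedge x^{\perp}=0$, $x\vee x^{\perp}=1$, $x\le y\Rightarrow y^{\perp}\le x^{\perp}$, and $x^{\perp\perp}=x$. An orthomodular lattice is an ortholattice satisfying: $x\le y$ implies $y=x\vee(x^{\perp}\wedge y)$. A quantum monadic algebra is an orthomodular lattice with a unary operation $\exists$ satisfying for all $x,y$: $\exists 0=0$; $x\le\exists x$; $\exists(x\vee y)=\exists x\vee\exists y$; $\exists\exists x=\exists x$; $\exists((\exists x)^{\perp})=(\exists x)^{\perp}$. A homomorphism of quantum monadic algebras is a bounded lattice homomorphism $h$ with $h(x^{\perp})=h(x)^{\perp}$ and $h(\exists x)=\exists h(x)$. A quasi-implication algebra is a magma $\langle A;\cdot\rangle$ satisfying, for all $x,y,z$: (1) $(x\cdot y)\cdot x=x$; (2) $(x\cdot y)\cdot(x\cdot z)=(y\cdot x)\cdot(y\cdot z)$; (3) $((x\cdot y)\cdot(y\cdot x))\cdot x=((y\cdot x)\cdot(x\cdot y))\cdot y$. In any quasi-implication algebra $x\cdot x=y\cdot y$ for all $x,y$, and $1$ denotes this common element. A bounded quasi-implication algebra is a quasi-implication algebra with a distinguished element $0$ such that $0\cdot x=1$ for all $x$. A monadic quasi-implication algebra is an algebra $\langle A;\cdot,0,\Diamond\rangle$ such that $\langle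 A;\cdot,0\rangle$ is a bounded quasi-implication algebra and $\Diamond\colon A\to A$ satisfies, for all $x,y$: (a) $\Diamond\Diamond x\cdot\Diamond x=1$ and $x\cdot\Diamond x=1$; (b) $\Diamond(\Diamond x\cdot 0)=\Diamond x\cdot 0$ and $\Diamond 0=0$; (c) $\Diamond(((x\cdot 0)\cdot(y\cdot 0))\cdot x)=((\Diamond x\cdot 0)\cdot(\Diamond y\cdot 0))\cdot\Diamond x$. A homomorphism of monadic quasi-implication algebras is a map $h$ with $h(x\cdot y)=h(x)\cdot h(y)$, $h(0)=0$ and $h(\Diamond x)=\Diamond h(x)$. *)

theory Defs
  imports "HOL-Algebra.Congruence"
begin

section \<open>Categories and isomorphisms of categories\<close>

record ('o, 'm) category =
  Obj :: "'o set"
  Arr :: "'m set"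
  Dom :: "'m \<Rightarrow> 'o"
  Cod :: "'m \<Rightarrow> 'o"
  Id :: "'o \<Rightarrow> 'm"
  Comp :: "'m \<Rightarrow> 'm \<Rightarrow> 'm"  \<comment> \<open>\<open>Comp C g f\<close> is \<open>g\<close> after \<open>f\<close>\<close>

locale category =
  fixes C :: "('o, 'm) category"
  assumes Dom_closed: "f \<in> Arr C \<Longrightarrow> Dom C f \<in> Obj C"
    and Cod_closed: "f \<in> Arr C \<Longrightarrow> Cod C f \<in> Obj C"
    and Id_closed: "A \<in> Obj C \<Longrightarrow> Id C A \<in> Arr C"
    and Dom_Id: "A \<in> Obj C \<Longrightarrow> Dom C (Id C A) = A"
    and Cod_Id: "A \<in> Obj C \<Longrightarrow> Cod C (Id C A) = A"
    and Comp_closed: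
      "\<lbrakk>f \<in> Arr C; g \<in> Arr C; Cod C f = Dom C g\<rbrakk> \<Longrightarrow> Comp C g f \<in> Arr C"
    and Dom_Comp:
      "\<lbrakk>f \<in> Arr C; g \<in> Arr C; Cod C f = Dom C g\<rbrakk> \<Longrightarrow> Dom C (Comp C g f) = Dom C f"
    and Cod_Comp:
      "\<lbrakk>f \<in> Arr C; g \<in> Arr C; Cod C f = Dom C g\<rbrakk> \<Longrightarrow> Cod C (Comp C g f) = Cod C g"
    and Comp_Id_right: "f \<in> Arr C \<Longrightarrow> Comp C f (Id C (Dom C f)) = f"
    and Comp_Id_left: "f \<in> Arr C \<Longrightarrow> Comp C (Id C (Cod C f)) f = f"
    and Comp_assoc:
      "\<lbrakk>f \<in> Arr C; g \<in> Arr C; h \<in> Arr C; Cod C f = Dom C g; Cod C g = Dom C h\<rbrakk>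
        \<Longrightarrow> Comp C h (Comp C g f) = Comp C (Comp C h g) f"

locale cat_functor = C: category C + D: category D
  for C :: "('o1, 'm1) category" and D :: "('o2, 'm2) category" +
  fixes Fo :: "'o1 \<Rightarrow> 'o2" and Fa :: "'m1 \<Rightarrow> 'm2"
  assumes obj_closed: "A \<in> Obj C \<Longrightarrow> Fo A \<in> Obj D"
    and arr_closed: "f \<in> Arr C \<Longrightarrow> Fa f \<in> Arr D"
    and preserves_Dom: "f \<in> Arr C \<Longrightarrow> Dom D (Fa f) = Fo (Dom C f)"
    and preserves_Cod: "f \<in> Arr C \<Longrightarrow> Cod D (Fa f) = Fo (Cod C f)"
    and preserves_Id: "A \<in> Obj C \<Longrightarrow> Fa (Id C A) = Id D (Fo A)"
    and preserves_Comp: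
      "\<lbrakk>f \<in> Arr C; g \<in> Arr C; Cod C f = Dom C g\<rbrakk>
        \<Longrightarrow> Fa (Comp C g f) = Comp D (Fa g) (Fa f)"

text \<open>Strict isomorphism (not mere equivalence): there are functors in both directions whose
  composites are equal to the identity functors.  That \<open>C\<close> and \<open>D\<close> are categories is part of
  \<^const>\<open>cat_functor\<close>.\<close>

definition isomorphic_categories :: "('o1, 'm1) category \<Rightarrow> ('o2, 'm2) category \<Rightarrow> bool" where
  "isomorphic_categories C D \<longleftrightarrow>
    (\<exists>Fo Fa Go Ga. cat_functor C D Fo Fa \<and> cat_functor D C Go Ga \<and>
      (\<forall>A\<in>Obj C. Go (Fo A) = A) \<and> (\<forall>f\<in>Arr C. Ga (Fa f) = f) \<and>
      (\<forall>B\<in>Obj D. Fo (Go B) = B) \<and> (\<forall>g\<in>Arr D. Fa (Ga g) = g))"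

text \<open>The category of structured sets with object class \<open>\<O>\<close> and hom-sets \<open>H A B\<close>.  An arrow
  is a triple (domain, map, codomain), so that arrows determine their domain and codomain.\<close>

definition structured_sets ::
  "('a, 'b) partial_object_scheme set
    \<Rightarrow> (('a, 'b) partial_object_scheme \<Rightarrow> ('a, 'b) partial_object_scheme \<Rightarrow> ('a \<Rightarrow> 'a) set)
    \<Rightarrow> (('a, 'b) partial_object_scheme,
        ('a, 'b) partial_object_scheme \<times> ('a \<Rightarrow> 'a) \<times> ('a, 'b) partial_object_scheme) category"
  where
  "structured_sets \<O> H =
    \<lparr>Obj = \<O>,
     Arr = {(A, h, B). A \<in> \<O> \<and> B \<in> \<O> \<and> h \<in> H A B},
     Dom = (\<lambda>(A, h, B). A),
     Cod = (\<lambda>(A, h, B). B),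
     Id = (\<lambda>A. (A, \<lambda>x\<in>carrier A. x, A)),
     Comp = (\<lambda>(B, g, C) (A, f, B'). (A, compose (carrier A) g f, C))\<rparr>"


section \<open>Quantum monadic algebras\<close>

text \<open>In all algebras below the operations are required to be extensional
  (\<open>\<rightarrow>\<^sub>E\<close>: equal to \<^const>\<open>undefined\<close> outside the carrier), and so are homomorphisms.  Hence two
  records are equal iff they have the same carrier and the same operations on it, which is
  what a strict isomorphism of categories needs.\<close>

record 'a ortho = "'a partial_object" +
  meet :: "['a, 'a] \<Rightarrow> 'a" (infixl "\<sqinter>\<index>" 70)
  join :: "['a, 'a] \<Rightarrow> 'a" (infixl "\<squnion>\<index>" 65)
  bottom :: 'a ("\<bottom>\<index>")
  top_el :: 'a ("\<top>\<index>")
  ocompl :: "'a \<Rightarrow> 'a" ("oc\<index> _" [81] 80)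

record 'a qma = "'a ortho" +
  quant :: "'a \<Rightarrow> 'a" ("ex\<index> _" [81] 80)

locale bounded_lattice_algebra =
  fixes L (structure)
  assumes meet_closed: "(\<sqinter>) \<in> carrier L \<rightarrow>\<^sub>E carrier L \<rightarrow>\<^sub>E carrier L"
    and join_closed: "(\<squnion>) \<in> carrier L \<rightarrow>\<^sub>E carrier L \<rightarrow>\<^sub>E carrier L"
    and bottom_closed: "\<bottom> \<in> carrier L"
    and top_closed: "\<top> \<in> carrier L"
    and meet_comm: "\<lbrakk>x \<in> carrier L; y \<in> carrier L\<rbrakk> \<Longrightarrow> x \<sqinter> y = y \<sqinter> x"
    and join_comm: "\<lbrakk>x \<in> carrier L; y \<in> carrier L\<rbrakk> \<Longrightarrow> x \<squnion> y = y \<squnion> x"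
    and meet_assoc:
      "\<lbrakk>x \<in> carrier L; y \<in> carrier L; z \<in> carrier L\<rbrakk> \<Longrightarrow> (x \<sqinter> y) \<sqinter> z = x \<sqinter> (y \<sqinter> z)"
    and join_assoc:
      "\<lbrakk>x \<in> carrier L; y \<in> carrier L; z \<in> carrier L\<rbrakk> \<Longrightarrow> (x \<squnion> y) \<squnion> z = x \<squnion> (y \<squnion> z)"
    and meet_absorb: "\<lbrakk>x \<in> carrier L; y \<in> carrier L\<rbrakk> \<Longrightarrow> x \<sqinter> (x \<squnion> y) = x"
    and join_absorb: "\<lbrakk>x \<in> carrier L; y \<in> carrier L\<rbrakk> \<Longrightarrow> x \<squnion> (x \<sqinter> y) = x"
    and bottom_least: "x \<in> carrier L \<Longrightarrow> \<bottom> \<sqinter> x = \<bottom>"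
    and top_greatest: "x \<in> carrier L \<Longrightarrow> x \<sqinter> \<top> = x"

definition lat_le :: "('a, 'b) ortho_scheme \<Rightarrow> 'a \<Rightarrow> 'a \<Rightarrow> bool" (infix "\<sqsubseteq>\<index>" 50) where
  "x \<sqsubseteq>\<^bsub>L\<^esub> y \<longleftrightarrow> x \<sqinter>\<^bsub>L\<^esub> y = x"

locale ortholattice = bounded_lattice_algebra +
  assumes ocompl_closed: "ocompl L \<in> carrier L \<rightarrow>\<^sub>E carrier L"
    and meet_ocompl: "x \<in> carrier L \<Longrightarrow> x \<sqinter> (oc x) = \<bottom>"
    and join_ocompl: "x \<in> carrier L \<Longrightarrow> x \<squnion> (oc x) = \<top>"
    and ocompl_antimono:
      "\<lbrakk>x \<in> carrier L; y \<in> carrier L; x \<sqsubseteq> y\<rbrakk> \<Longrightarrow> (oc y) \<sqsubseteq> (oc x)"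
    and ocompl_ocompl: "x \<in> carrier L \<Longrightarrow> oc (oc x) = x"

locale orthomodular_lattice = ortholattice +
  assumes orthomodular:
    "\<lbrakk>x \<in> carrier L; y \<in> carrier L; x \<sqsubseteq> y\<rbrakk> \<Longrightarrow> y = x \<squnion> ((oc x) \<sqinter> y)"

locale quantum_monadic_algebra = orthomodular_lattice Q for Q :: "'a qma" (structure) +
  assumes quant_closed: "quant Q \<in> carrier Q \<rightarrow>\<^sub>E carrier Q"
    and quant_bottom: "ex \<bottom> = \<bottom>"
    and quant_increasing: "x \<in> carrier Q \<Longrightarrow> x \<sqsubseteq> ex x"
    and quant_join:
      "\<lbrakk>x \<in> carrier Q; y \<in> carrier Q\<rbrakk> \<Longrightarrow> ex (x \<squnion> y) = (ex x) \<squnion> (ex y)"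
    and quant_quant: "x \<in> carrier Q \<Longrightarrow> ex (ex x) = ex x"
    and quant_ocompl_quant: "x \<in> carrier Q \<Longrightarrow> ex (oc (ex x)) = oc (ex x)"

definition qma_hom :: "'a qma \<Rightarrow> 'a qma \<Rightarrow> ('a \<Rightarrow> 'a) set" where
  "qma_hom A B = {h \<in> carrier A \<rightarrow>\<^sub>E carrier B.
    (\<forall>x\<in>carrier A. \<forall>y\<in>carrier A. h (x \<sqinter>\<^bsub>A\<^esub> y) = h x \<sqinter>\<^bsub>B\<^esub> h y) \<and>
    (\<forall>x\<in>carrier A. \<forall>y\<in>carrier A. h (x \<squnion>\<^bsub>A\<^esub> y) = h x \<squnion>\<^bsub>B\<^esub> h y) \<and>
    h \<bottom>\<^bsub>A\<^esub> = \<bottom>\<^bsub>B\<^esub> \<and> h \<top>\<^bsub>A\<^esub> = \<top>\<^bsub>B\<^esub> \<and>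
    (\<forall>x\<in>carrier A. h (oc\<^bsub>A\<^esub> x) = oc\<^bsub>B\<^esub> (h x)) \<and>
    (\<forall>x\<in>carrier A. h (ex\<^bsub>A\<^esub> x) = ex\<^bsub>B\<^esub> (h x))}"

text \<open>The underlying sets of the objects range over all subsets of the type \<open>'a\<close>, which acts as
  the universe of the category.\<close>

definition QMA :: "('a qma, 'a qma \<times> ('a \<Rightarrow> 'a) \<times> 'a qma) category" where
  "QMA = structured_sets {A. quantum_monadic_algebra A} qma_hom"


section \<open>Monadic quasi-implication algebras\<close>

record 'a magma = "'a partial_object" +
  imp :: "['a, 'a] \<Rightarrow> 'a" (infixl "\<cdot>\<index>" 70)

record 'a bounded_magma = "'a magma" +
  zero :: 'a ("\<zero>\<index>")

record 'a mqia = "'a bounded_magma" +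
  diamond :: "'a \<Rightarrow> 'a" ("\<diamond>\<index> _" [81] 80)

locale quasi_implication_algebra =
  fixes A (structure)
  assumes imp_closed: "(\<cdot>) \<in> carrier A \<rightarrow>\<^sub>E carrier A \<rightarrow>\<^sub>E carrier A"
    and qi1: "\<lbrakk>x \<in> carrier A; y \<in> carrier A\<rbrakk> \<Longrightarrow> (x \<cdot> y) \<cdot> x = x"
    and qi2: "\<lbrakk>x \<in> carrier A; y \<in> carrier A; z \<in> carrier A\<rbrakk>
      \<Longrightarrow> (x \<cdot> y) \<cdot> (x \<cdot> z) = (y \<cdot> x) \<cdot> (y \<cdot> z)"
    and qi3: "\<lbrakk>x \<in> carrier A; y \<in> carrier A\<rbrakk>
      \<Longrightarrow> ((x \<cdot> y) \<cdot> (y \<cdot> x)) \<cdot> x = ((y \<cdot> x) \<cdot> (x \<cdot> y)) \<cdot> y"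

text \<open>The common value of all \<open>x \<cdot> x\<close>; it is unspecified when the carrier is empty, which
  cannot happen for bounded algebras.\<close>

definition one :: "('a, 'b) magma_scheme \<Rightarrow> 'a" ("\<one>\<index>") where
  "\<one>\<^bsub>A\<^esub> = (THE u. \<forall>x\<in>carrier A. x \<cdot>\<^bsub>A\<^esub> x = u)"

context quasi_implication_algebra
begin

lemma imp_in_carrier: "\<lbrakk>x \<in> carrier A; y \<in> carrier A\<rbrakk> \<Longrightarrow> x \<cdot> y \<in> carrier A"
  using imp_closed by (meson PiE_mem)

lemma imp_imp_self:
  assumes x: "x \<in> carrier A" and y: "y \<in> carrier A"
  shows "(x \<cdot> y) \<cdot> (x \<cdot> y) = y \<cdot> y"
proof -
  have yx: "y \<cdot> x \<in> carrier A" by (rule imp_in_carrier[OF y x])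
  have "y \<cdot> (y \<cdot> x) = y \<cdot> x"
    using qi1[OF yx y] qi1[OF y x] by simp
  moreover have "((y \<cdot> x) \<cdot> y) \<cdot> ((y \<cdot> x) \<cdot> y) = (y \<cdot> (y \<cdot> x)) \<cdot> (y \<cdot> y)"
    by (rule qi2[OF yx y y])
  ultimately have "y \<cdot> y = (y \<cdot> x) \<cdot> (y \<cdot> y)"
    using qi1[OF y x] by simp
  also have "\<dots> = (x \<cdot> y) \<cdot> (x \<cdot> y)" by (rule qi2[OF y x y])
  finally show ?thesis by (rule sym)
qed

lemma imp_self_eq:
  assumes x: "x \<in> carrier A" and y: "y \<in> carrier A"
  shows "x \<cdot> x = y \<cdot> y"
proof -
  have xy: "x \<cdot> y \<in> carrier A" and yx: "y \<cdot> x \<in> carrier A"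
    using imp_in_carrier x y by auto
  show ?thesis
    using imp_imp_self[OF imp_in_carrier[OF xy yx] x] imp_imp_self[OF imp_in_carrier[OF yx xy] y]
    unfolding qi3[OF x y] by simp
qed

lemma imp_self:
  assumes x: "x \<in> carrier A"
  shows "x \<cdot> x = \<one>"
proof -
  have "(THE u. \<forall>z\<in>carrier A. z \<cdot> z = u) = x \<cdot> x"
  proof (rule the_equality)
    show "\<forall>z\<in>carrier A. z \<cdot> z = x \<cdot> x" using imp_self_eq[OF _ x] by blast
  next
    fix u assume "\<forall>z\<in>carrier A. z \<cdot> z = u"
    then show "u = x \<cdot> x" using x by (blast intro: sym)
  qed
  then show ?thesis unfolding one_def by (rule sym)
qed

end

locale bounded_quasi_implication_algebra = quasi_implication_algebra +
  assumes zero_closed: "\<zero> \<in> carrier A"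
    and zero_imp: "x \<in> carrier A \<Longrightarrow> \<zero> \<cdot> x = \<one>"

locale monadic_quasi_implication_algebra = bounded_quasi_implication_algebra A
  for A :: "'a mqia" (structure) +
  assumes diamond_closed: "diamond A \<in> carrier A \<rightarrow>\<^sub>E carrier A"
    and diamond_diamond: "x \<in> carrier A \<Longrightarrow> (\<diamond> (\<diamond> x)) \<cdot> (\<diamond> x) = \<one>"
    and diamond_increasing: "x \<in> carrier A \<Longrightarrow> x \<cdot> (\<diamond> x) = \<one>"
    and diamond_compl: "x \<in> carrier A \<Longrightarrow> \<diamond> ((\<diamond> x) \<cdot> \<zero>) = (\<diamond> x) \<cdot> \<zero>"
    and diamond_zero: "\<diamond> \<zero> = \<zero>"
    and diamond_join: "\<lbrakk>x \<in> carrier A; y \<in> carrier A\<rbrakk>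
      \<Longrightarrow> \<diamond> (((x \<cdot> \<zero>) \<cdot> (y \<cdot> \<zero>)) \<cdot> x)
        = (((\<diamond> x) \<cdot> \<zero>) \<cdot> ((\<diamond> y) \<cdot> \<zero>)) \<cdot> (\<diamond> x)"

definition mqia_hom :: "'a mqia \<Rightarrow> 'a mqia \<Rightarrow> ('a \<Rightarrow> 'a) set" where
  "mqia_hom A B = {h \<in> carrier A \<rightarrow>\<^sub>E carrier B.
    (\<forall>x\<in>carrier A. \<forall>y\<in>carrier A. h (x \<cdot>\<^bsub>A\<^esub> y) = h x \<cdot>\<^bsub>B\<^esub> h y) \<and>
    h \<zero>\<^bsub>A\<^esub> = \<zero>\<^bsub>B\<^esub> \<and>
    (\<forall>x\<in>carrier A. h (\<diamond>\<^bsub>A\<^esub> x) = \<diamond>\<^bsub>B\<^esub> (h x))}"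

definition MQIA :: "('a mqia, 'a mqia \<times> ('a \<Rightarrow> 'a) \<times> 'a mqia) category" where
  "MQIA = structured_sets {A. monadic_quasi_implication_algebra A} mqia_hom"

end

theory Submission
  imports Defs
begin

text \<open>The two classes of algebras are term equivalent via the Sasaki hook
  \<open>x \<cdot> y = x\<^sup>\<bottom> \<or> (x \<and> y)\<close>, with \<open>x\<^sup>\<bottom> = x \<cdot> 0\<close>, \<open>x \<or> y = (x\<^sup>\<bottom> \<cdot> y\<^sup>\<bottom>) \<cdot> x\<close> and
  \<open>x \<and> y = ((x \<cdot> y) \<cdot> x\<^sup>\<bottom>)\<^sup>\<bottom>\<close> in the other direction.  In an orthomodular lattice
  \<open>(x \<cdot> y) \<cdot> (x \<cdot> z) = (x \<and> y) \<cdot> z\<close> and \<open>((x \<cdot> y) \<cdot> (y \<cdot> x)) \<cdot> x = x \<or> y\<close>, which gives the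
  axioms (2) and (3).  In a bounded quasi-implication algebra, \<open>x \<cdot> y = 1\<close> is a partial order
  on which \<open>x \<mapsto> x \<cdot> 0\<close> is an antitone involution; (2) says that the meet above commutes, and
  orthomodularity follows from \<open>(y \<cdot> x) \<cdot> x = y\<close> for \<open>x \<le> y\<close>, a case of (3).\<close>

section \<open>Orthomodular lattices\<close>

context bounded_lattice_algebra
begin

section \<open>The lattice order and the universal properties of meet and join\<close>

lemma meet_in_carrier [simp]: "\<lbrakk>x \<in> carrier L; y \<in> carrier L\<rbrakk> \<Longrightarrow> x \<sqinter> y \<in> carrier L"
  using meet_closed by (meson PiE_mem)

lemma join_in_carrier [simp]: "\<lbrakk>x \<in> carrier L; y \<in> carrier L\<rbrakk> \<Longrightarrow> x \<squnion> y \<in> carrier L"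
  using join_closed by (meson PiE_mem)

declare bottom_closed [simp] top_closed [simp]

lemma meet_idem: "x \<in> carrier L \<Longrightarrow> x \<sqinter> x = x"
  using meet_absorb[of x "x \<sqinter> x"] join_absorb[of x x] by simp

lemma le_antisym: "\<lbrakk>x \<sqsubseteq> y; y \<sqsubseteq> x; x \<in> carrier L; y \<in> carrier L\<rbrakk> \<Longrightarrow> x = y"
  using meet_comm[of x y] by (simp add: lat_le_def)

lemma meet_le1: "\<lbrakk>x \<in> carrier L; y \<in> carrier L\<rbrakk> \<Longrightarrow> x \<sqinter> y \<sqsubseteq> x"
  unfolding lat_le_def by (metis meet_assoc meet_comm meet_idem)

lemma meet_le2: "\<lbrakk>x \<in> carrier L; y \<in> carrier L\<rbrakk> \<Longrightarrow> x \<sqinter> y \<sqsubseteq> y"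
  unfolding lat_le_def by (metis meet_assoc meet_idem)

lemma le_meetI:
  "\<lbrakk>z \<sqsubseteq> x; z \<sqsubseteq> y; x \<in> carrier L; y \<in> carrier L; z \<in> carrier L\<rbrakk> \<Longrightarrow> z \<sqsubseteq> x \<sqinter> y"
  unfolding lat_le_def by (metis meet_assoc)

lemma le_iff_join: "\<lbrakk>x \<in> carrier L; y \<in> carrier L\<rbrakk> \<Longrightarrow> x \<sqsubseteq> y \<longleftrightarrow> x \<squnion> y = y"
  unfolding lat_le_def by (metis join_absorb join_comm meet_absorb meet_comm)

lemma join_le1: "\<lbrakk>x \<in> carrier L; y \<in> carrier L\<rbrakk> \<Longrightarrow> x \<sqsubseteq> x \<squnion> y"
  by (simp add: lat_le_def meet_absorb)

lemma join_le2: "\<lbrakk>x \<in> carrier L; y \<in> carrier L\<rbrakk> \<Longrightarrow> y \<sqsubseteq> x \<squnion> y"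
  using join_le1[of y x] by (simp add: join_comm)

lemma join_leI:
  "\<lbrakk>x \<sqsubseteq> z; y \<sqsubseteq> z; x \<in> carrier L; y \<in> carrier L; z \<in> carrier L\<rbrakk> \<Longrightarrow> x \<squnion> y \<sqsubseteq> z"
  by (simp add: le_iff_join join_assoc)

lemma join_left_comm:
  "\<lbrakk>x \<in> carrier L; y \<in> carrier L; z \<in> carrier L\<rbrakk> \<Longrightarrow> x \<squnion> (y \<squnion> z) = y \<squnion> (x \<squnion> z)"
  using join_assoc[of x y z] join_assoc[of y x z] by (simp add: join_comm[of x y])

lemma join_bottom: "x \<in> carrier L \<Longrightarrow> x \<squnion> \<bottom> = x"
  using le_iff_join[of \<bottom> x] by (simp add: lat_le_def bottom_least join_comm)

lemma meet_bottom: "x \<in> carrier L \<Longrightarrow> x \<sqinter> \<bottom> = \<bottom>"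
  using bottom_least meet_comm by simp

end

context ortholattice
begin

lemma ocompl_in_carrier [simp]: "x \<in> carrier L \<Longrightarrow> oc x \<in> carrier L"
  using ocompl_closed by (meson PiE_mem)

declare ocompl_ocompl [simp]

lemma ocompl_le_iff: "\<lbrakk>x \<in> carrier L; y \<in> carrier L\<rbrakk> \<Longrightarrow> oc x \<sqsubseteq> y \<longleftrightarrow> oc y \<sqsubseteq> x"
  using ocompl_antimono[of "oc x" y] ocompl_antimono[of "oc y" x] by auto

text \<open>De Morgan follows from the order alone: an antitone involution exchanges lower bounds
  and upper bounds.\<close>

lemma ocompl_meet:
  assumes x: "x \<in> carrier L" and y: "y \<in> carrier L"
  shows "oc (x \<sqinter> y) = oc x \<squnion> oc y"
proof (rule le_antisym)
  have "oc (oc x \<squnion> oc y) \<sqsubseteq> x" "oc (oc x \<squnion> oc y) \<sqsubseteq> y"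
    using x y by (simp_all add: ocompl_le_iff[of "_ \<squnion> _"] join_le1 join_le2)
  then have "oc (oc x \<squnion> oc y) \<sqsubseteq> x \<sqinter> y" using x y by (simp add: le_meetI)
  then show "oc (x \<sqinter> y) \<sqsubseteq> oc x \<squnion> oc y"
    using x y by (simp add: ocompl_le_iff[of "_ \<sqinter> _"])
  show "oc x \<squnion> oc y \<sqsubseteq> oc (x \<sqinter> y)"
    using x y by (intro join_leI ocompl_antimono meet_le1 meet_le2) auto
qed (use x y in auto)

lemma ocompl_join:
  assumes "x \<in> carrier L" and "y \<in> carrier L"
  shows "oc (x \<squnion> y) = oc x \<sqinter> oc y"
  using ocompl_meet[of "oc x" "oc y"] ocompl_ocompl[of "oc x \<sqinter> oc y"] assms by simp

section \<open>The Sasaki hook in an ortholattice\<close>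

definition sasaki :: "'a \<Rightarrow> 'a \<Rightarrow> 'a" where
  "sasaki x y = oc x \<squnion> (x \<sqinter> y)"

lemma sasaki_in_carrier [simp]:
  "\<lbrakk>x \<in> carrier L; y \<in> carrier L\<rbrakk> \<Longrightarrow> sasaki x y \<in> carrier L"
  by (simp add: sasaki_def)

lemma sasaki_self: "x \<in> carrier L \<Longrightarrow> sasaki x x = \<top>"
  by (simp add: sasaki_def meet_idem join_comm join_ocompl)

lemma sasaki_eq_top:
  "\<lbrakk>x \<in> carrier L; y \<in> carrier L; x \<sqsubseteq> y\<rbrakk> \<Longrightarrow> sasaki x y = \<top>"
  by (simp add: sasaki_def lat_le_def join_comm join_ocompl)

lemma sasaki_bottom: "x \<in> carrier L \<Longrightarrow> sasaki x \<bottom> = oc x"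
  by (simp add: sasaki_def meet_bottom join_bottom)

lemma bottom_sasaki: "x \<in> carrier L \<Longrightarrow> sasaki \<bottom> x = \<top>"
  by (rule sasaki_eq_top) (simp_all add: lat_le_def bottom_least)

end

context orthomodular_lattice
begin

text \<open>The dual of the orthomodular law, obtained by applying the law to
  \<open>oc y \<sqsubseteq> oc x\<close> and complementing.\<close>

lemma orthomodular_meet:
  assumes x: "x \<in> carrier L" and y: "y \<in> carrier L" and le: "x \<sqsubseteq> y"
  shows "y \<sqinter> (oc y \<squnion> x) = x"
proof -
  have "oc y \<sqsubseteq> oc x" using assms by (simp add: ocompl_antimono)
  then have "oc x = oc y \<squnion> (oc (oc y) \<sqinter> oc x)" using x y by (intro orthomodular) auto
  then have "oc (oc x) = oc (oc y \<squnion> (oc (oc y) \<sqinter> oc x))" by simp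
  then show ?thesis using x y by (simp add: ocompl_join ocompl_meet)
qed

lemma meet_sasaki: "\<lbrakk>x \<in> carrier L; y \<in> carrier L\<rbrakk> \<Longrightarrow> x \<sqinter> sasaki x y = x \<sqinter> y"
  unfolding sasaki_def by (rule orthomodular_meet) (auto simp: meet_le1)

lemma ocompl_sasaki:
  "\<lbrakk>x \<in> carrier L; y \<in> carrier L\<rbrakk> \<Longrightarrow> oc (sasaki x y) = x \<sqinter> oc (x \<sqinter> y)"
  by (simp add: sasaki_def ocompl_join)

text \<open>Splits \<open>x\<close> into two orthogonal pieces. The second one is
  \<open>oc (sasaki x y)\<close>, so the splitting appears whenever a hook is complemented.\<close>

lemma join_meet_ocompl:
  "\<lbrakk>x \<in> carrier L; y \<in> carrier L\<rbrakk> \<Longrightarrow> (x \<sqinter> y) \<squnion> (x \<sqinter> oc (x \<sqinter> y)) = x"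
  using orthomodular[of "x \<sqinter> y" x] by (simp add: meet_le1 meet_comm[of x "oc _"])

text \<open>The complement of \<open>sasaki x y\<close> and its meet with \<open>x\<close> are
  exactly the two orthogonal pieces of \<open>x\<close>.\<close>

lemma sasaki_1:
  assumes x: "x \<in> carrier L" and y: "y \<in> carrier L"
  shows "sasaki (sasaki x y) x = x"
proof -
  have "sasaki (sasaki x y) x = (x \<sqinter> oc (x \<sqinter> y)) \<squnion> (x \<sqinter> y)"
    using x y meet_sasaki[OF x y] meet_comm[of x "sasaki x y"]
    by (simp add: sasaki_def[of "sasaki x y"] ocompl_sasaki)
  then show ?thesis using x y by (simp add: join_comm join_meet_ocompl)
qed

text \<open>Both hooks lie above \<open>oc x\<close>, so the orthomodular law rebuilds their meet
  from \<open>oc x\<close> and its part below \<open>x\<close>; in that part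
  \<open>meet_sasaki\<close> removes the hooks.\<close>

lemma meet_sasaki_sasaki:
  assumes x: "x \<in> carrier L" and y: "y \<in> carrier L" and z: "z \<in> carrier L"
  shows "sasaki x y \<sqinter> sasaki x z = oc x \<squnion> ((x \<sqinter> y) \<sqinter> z)"
proof -
  let ?u = "sasaki x y \<sqinter> sasaki x z"
  have le: "oc x \<sqsubseteq> ?u"
    using x y z by (intro le_meetI) (auto simp: sasaki_def join_le1)
  have "x \<sqinter> ?u = (x \<sqinter> sasaki x y) \<sqinter> sasaki x z"
    using x y z by (simp add: meet_assoc)
  also have "\<dots> = y \<sqinter> (x \<sqinter> sasaki x z)"
    using x y z by (simp add: meet_sasaki meet_comm[of x y] meet_assoc)
  also have "\<dots> = (x \<sqinter> y) \<sqinter> z"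
    using x y z by (simp add: meet_sasaki meet_comm[of x y] meet_assoc)
  finally have "x \<sqinter> ?u = (x \<sqinter> y) \<sqinter> z" .
  then show ?thesis using orthomodular[OF _ _ le] x y z by simp
qed

text \<open>The right side is symmetric in \<open>x\<close> and \<open>y\<close>, which yields axiom
  (2). Setting \<open>z\<close> to \<open>\<bottom>\<close> yields the terms for join and
  meet.\<close>

lemma sasaki_2_meet:
  assumes x: "x \<in> carrier L" and y: "y \<in> carrier L" and z: "z \<in> carrier L"
  shows "sasaki (sasaki x y) (sasaki x z) = sasaki (x \<sqinter> y) z"
proof -
  let ?p = "x \<sqinter> y"
  \<comment> \<open>This splitting merges the pieces \<open>oc x\<close> and
    \<open>x \<sqinter> oc ?p\<close> of the outer hook into the single complement
    \<open>oc ?p\<close>.\<close>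
  have "oc x \<sqsubseteq> oc ?p" using x y by (simp add: ocompl_antimono meet_le1)
  then have p: "oc ?p = oc x \<squnion> (x \<sqinter> oc ?p)" using orthomodular[of "oc x" "oc ?p"] x y by simp
  have "sasaki (sasaki x y) (sasaki x z) = (x \<sqinter> oc ?p) \<squnion> (oc x \<squnion> (?p \<sqinter> z))"
    using x y z by (simp add: sasaki_def[of "sasaki x y"] ocompl_sasaki meet_sasaki_sasaki)
  also have "\<dots> = (oc x \<squnion> (x \<sqinter> oc ?p)) \<squnion> (?p \<sqinter> z)"
    using x y z by (simp add: join_left_comm[of "x \<sqinter> oc ?p"] join_assoc)
  also have "\<dots> = sasaki ?p z" using p by (simp add: sasaki_def)
  finally show ?thesis .
qed

text \<open>Symmetry of the right side yields axiom (3). Both elements split over \<open>?p\<close>,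
  as \<open>?p \<squnion> x1\<close> and \<open>?p \<squnion> y1\<close>; the inner hook is
  \<open>x \<squnion> v\<close>, and orthomodularity for
  \<open>x1 \<sqsubseteq> x1 \<squnion> y1\<close> rebuilds the join.\<close>

lemma sasaki_3_join:
  assumes x: "x \<in> carrier L" and y: "y \<in> carrier L"
  shows "sasaki (sasaki (sasaki x y) (sasaki y x)) x = x \<squnion> y"
proof -
  let ?p = "x \<sqinter> y"
  define v where "v = sasaki x y \<sqinter> sasaki y x"
  define x1 where "x1 = x \<sqinter> oc ?p"
  define y1 where "y1 = y \<sqinter> oc ?p"
  have p: "?p \<in> carrier L" and vc: "v \<in> carrier L"
    and x1: "x1 \<in> carrier L" and y1: "y1 \<in> carrier L"
    using x y by (simp_all add: v_def x1_def y1_def)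
  have xp: "?p \<squnion> x1 = x" using x y by (simp add: x1_def join_meet_ocompl)
  have yp: "?p \<squnion> y1 = y" using join_meet_ocompl[OF y x] by (simp add: y1_def meet_comm[OF x y])
  have ov: "oc v = x1 \<squnion> y1"
    using x y by (simp add: v_def x1_def y1_def ocompl_meet[of "sasaki _ _"] ocompl_sasaki
        meet_comm[of y x])
  have pv: "?p \<sqsubseteq> v"
    using x y by (auto simp: v_def sasaki_def meet_comm[of y x] intro!: le_meetI join_le2)
  have "sasaki (sasaki x y) (sasaki y x) = x1 \<squnion> v"
    using x y by (simp add: sasaki_def[of "sasaki x y"] ocompl_sasaki v_def x1_def)
  \<comment> \<open>As \<open>?p\<close> lies below \<open>v\<close>, it can be joined without
    effect and then completes \<open>x1\<close> to \<open>x\<close>.\<close>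
  also have "\<dots> = x1 \<squnion> (?p \<squnion> v)" using pv p vc by (simp add: le_iff_join)
  also have "\<dots> = x \<squnion> v" using x1 p vc xp by (metis join_assoc join_comm)
  finally have c: "sasaki (sasaki x y) (sasaki y x) = x \<squnion> v" .
  have "sasaki (x \<squnion> v) x = oc (x \<squnion> v) \<squnion> x"
    using x vc by (simp add: sasaki_def meet_comm[of "x \<squnion> v"] meet_absorb)
  also have "oc (x \<squnion> v) = oc x1 \<sqinter> (x1 \<squnion> y1)"
  proof -
    \<comment> \<open>In \<open>oc x = oc x1 \<sqinter> oc ?p\<close> the factor
      \<open>oc ?p\<close> is absorbed by \<open>oc v\<close>, so only \<open>oc x1\<close>
      remains.\<close>
    have "oc v \<sqsubseteq> oc ?p" using pv p vc by (simp add: ocompl_antimono)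
    then have "oc ?p \<sqinter> oc v = oc v"
      using p vc by (simp add: lat_le_def meet_comm[of "oc ?p"])
    moreover have "oc x = oc x1 \<sqinter> oc ?p"
      using xp p x1 by (metis join_comm ocompl_join)
    ultimately show ?thesis using x vc x1 y1 p by (simp add: ocompl_join[of x v] meet_assoc ov)
  qed
  also have "\<dots> \<squnion> x = ?p \<squnion> (x1 \<squnion> (oc x1 \<sqinter> (x1 \<squnion> y1)))"
  proof -
    have "\<dots> \<squnion> x = (?p \<squnion> x1) \<squnion> (oc x1 \<sqinter> (x1 \<squnion> y1))"
      using x x1 y1 by (simp add: xp join_comm[of x])
    then show ?thesis using x1 y1 p by (simp add: join_assoc)
  qed
  also have "x1 \<squnion> (oc x1 \<sqinter> (x1 \<squnion> y1)) = x1 \<squnion> y1"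
    using orthomodular[of x1 "x1 \<squnion> y1"] x1 y1 by (simp add: join_le1)
  also have "?p \<squnion> (x1 \<squnion> y1) = x \<squnion> y1" using p x1 y1 by (simp add: xp flip: join_assoc)
  \<comment> \<open>\<open>x\<close> already contains \<open>?p\<close>, which is duplicated here to
    complete \<open>y1\<close> to \<open>y\<close>.\<close>
  also have "\<dots> = x \<squnion> (?p \<squnion> y1)"
    using p x1 y1 x y xp by (metis join_absorb join_assoc)
  finally show ?thesis using c yp by simp
qed

lemma sasaki_join:
  assumes "x \<in> carrier L" and "y \<in> carrier L"
  shows "sasaki (sasaki (oc x) (oc y)) x = x \<squnion> y"
  using sasaki_2_meet[of "oc x" "oc y" \<bottom>] assms by (simp add: sasaki_bottom ocompl_meet)

lemma sasaki_meet:
  assumes "x \<in> carrier L" and "y \<in> carrier L"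
  shows "oc (sasaki (sasaki x y) (oc x)) = x \<sqinter> y"
  using sasaki_2_meet[of x y \<bottom>] assms by (simp add: sasaki_bottom)

end

section \<open>Bounded quasi-implication algebras\<close>

context bounded_quasi_implication_algebra
begin

declare imp_in_carrier [simp] zero_closed [simp]

lemma one_closed [simp]: "\<one> \<in> carrier A"
  using imp_in_carrier[of \<zero> \<zero>] imp_self[of \<zero>] by simp

lemma one_imp [simp]: "x \<in> carrier A \<Longrightarrow> \<one> \<cdot> x = x"
  using qi1[of x x] by (simp add: imp_self)

text \<open>Axiom (1) for the pair \<open>x \<cdot> y\<close>, \<open>x\<close>, whose inner product
  \<open>(x \<cdot> y) \<cdot> x\<close> is again \<open>x\<close>.\<close>

lemma imp_imp [simp]: "\<lbrakk>x \<in> carrier A; y \<in> carrier A\<rbrakk> \<Longrightarrow> x \<cdot> (x \<cdot> y) = x \<cdot> y"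
  using qi1[of "x \<cdot> y" x] qi1[of x y] by simp

lemma imp_one [simp]:
  assumes x: "x \<in> carrier A"
  shows "x \<cdot> \<one> = \<one>"
proof -
  have "(x \<cdot> \<one>) \<cdot> (x \<cdot> x) = (\<one> \<cdot> x) \<cdot> (\<one> \<cdot> x)" using x by (intro qi2) auto
  then have *: "(x \<cdot> \<one>) \<cdot> \<one> = \<one>" using x by (simp add: imp_self)
  then show ?thesis using qi2[of x \<one> \<one>] x by (simp add: imp_self)
qed

section \<open>Order, complement and lattice operations obtained from the product\<close>

definition below :: "'a \<Rightarrow> 'a \<Rightarrow> bool" (infix "\<preceq>" 50) where
  "x \<preceq> y \<longleftrightarrow> x \<cdot> y = \<one>"

definition compl :: "'a \<Rightarrow> 'a" where
  "compl x = x \<cdot> \<zero>"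

definition inf_imp :: "'a \<Rightarrow> 'a \<Rightarrow> 'a" where
  "inf_imp x y = compl ((x \<cdot> y) \<cdot> compl x)"

definition sup_imp :: "'a \<Rightarrow> 'a \<Rightarrow> 'a" where
  "sup_imp x y = (compl x \<cdot> compl y) \<cdot> x"

lemma compl_closed [simp]: "x \<in> carrier A \<Longrightarrow> compl x \<in> carrier A"
  by (simp add: compl_def)

lemma inf_imp_closed [simp]: "\<lbrakk>x \<in> carrier A; y \<in> carrier A\<rbrakk> \<Longrightarrow> inf_imp x y \<in> carrier A"
  by (simp add: inf_imp_def)

lemma sup_imp_closed [simp]: "\<lbrakk>x \<in> carrier A; y \<in> carrier A\<rbrakk> \<Longrightarrow> sup_imp x y \<in> carrier A"
  by (simp add: sup_imp_def)

lemma below_refl [simp]: "x \<in> carrier A \<Longrightarrow> x \<preceq> x"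
  by (simp add: below_def imp_self)

text \<open>When both products are \<open>\<one>\<close>, axiom (3) reads
  \<open>x = y\<close>.\<close>

lemma below_antisym: "\<lbrakk>x \<preceq> y; y \<preceq> x; x \<in> carrier A; y \<in> carrier A\<rbrakk> \<Longrightarrow> x = y"
  using qi3[of x y] by (simp add: below_def)

lemma below_trans:
  "\<lbrakk>x \<preceq> y; y \<preceq> z; x \<in> carrier A; y \<in> carrier A; z \<in> carrier A\<rbrakk> \<Longrightarrow> x \<preceq> z"
  using qi2[of x y z] by (simp add: below_def)

lemma zero_below [simp]: "x \<in> carrier A \<Longrightarrow> \<zero> \<preceq> x"
  by (simp add: below_def zero_imp)

lemma below_one [simp]: "x \<in> carrier A \<Longrightarrow> x \<preceq> \<one>"
  by (simp add: below_def)

lemma imp_mono: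
  "\<lbrakk>y \<preceq> z; x \<in> carrier A; y \<in> carrier A; z \<in> carrier A\<rbrakk> \<Longrightarrow> x \<cdot> y \<preceq> x \<cdot> z"
  using qi2[of x y z] by (simp add: below_def)

lemma compl_below_imp: "\<lbrakk>x \<in> carrier A; y \<in> carrier A\<rbrakk> \<Longrightarrow> compl x \<preceq> x \<cdot> y"
  unfolding compl_def by (intro imp_mono) auto

lemma compl_compl [simp]:
  "x \<in> carrier A \<Longrightarrow> compl (compl x) = x"
  using qi3[of x \<zero>] by (simp add: compl_def zero_imp)

text \<open>Axiom (2) with third argument \<open>x \<cdot> y\<close>: by \<open>imp_imp\<close> one
  side becomes the square of \<open>x \<cdot> y\<close>, hence \<open>\<one>\<close>.\<close>

lemma below_imp_self:
  "\<lbrakk>y \<preceq> x; x \<in> carrier A; y \<in> carrier A\<rbrakk> \<Longrightarrow> y \<preceq> x \<cdot> y"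
  using qi2[of y x "x \<cdot> y"] by (simp add: below_def imp_self)

text \<open>Axiom (2) with third argument \<open>\<zero>\<close>. The right side is
  \<open>compl (inf_imp y x)\<close>, so this underlies both antitonicity of \<open>compl\<close>
  and the greatest lower bound property.\<close>

lemma compl_eq_imp:
  "\<lbrakk>x \<preceq> y; x \<in> carrier A; y \<in> carrier A\<rbrakk> \<Longrightarrow> compl x = (y \<cdot> x) \<cdot> compl y"
  using qi2[of x y \<zero>] by (simp add: below_def compl_def)

text \<open>\<open>compl y\<close> lies below \<open>y \<cdot> x\<close>, hence below
  \<open>(y \<cdot> x) \<cdot> compl y\<close>, which is \<open>compl x\<close>.\<close>

lemma compl_antimono:
  "\<lbrakk>x \<preceq> y; x \<in> carrier A; y \<in> carrier A\<rbrakk> \<Longrightarrow> compl y \<preceq> compl x"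
  using below_imp_self[of "compl y" "y \<cdot> x"] by (simp add: compl_eq_imp compl_below_imp)

lemma compl_below_iff: "\<lbrakk>x \<in> carrier A; y \<in> carrier A\<rbrakk> \<Longrightarrow> compl x \<preceq> y \<longleftrightarrow> compl y \<preceq> x"
  using compl_antimono[of "compl x" y] compl_antimono[of "compl y" x] by auto

lemma below_compl_iff: "\<lbrakk>x \<in> carrier A; y \<in> carrier A\<rbrakk> \<Longrightarrow> x \<preceq> compl y \<longleftrightarrow> y \<preceq> compl x"
  using compl_antimono[of x "compl y"] compl_antimono[of y "compl x"] by auto

text \<open>A hook is not antitone in its first argument in general; the common lower bound
  \<open>z\<close> puts \<open>y \<cdot> z\<close> below \<open>y \<cdot> x\<close>, so that
  \<open>below_imp_self\<close> applies.\<close>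

lemma imp_antimono:
  assumes "z \<preceq> x" "x \<preceq> y" and "x \<in> carrier A" "y \<in> carrier A" "z \<in> carrier A"
  shows "y \<cdot> z \<preceq> x \<cdot> z"
proof -
  have "x \<cdot> z = (y \<cdot> x) \<cdot> (y \<cdot> z)" using qi2[of x y z] assms by (simp add: below_def)
  then show ?thesis using below_imp_self[of "y \<cdot> z" "y \<cdot> x"] imp_mono[of z x y] assms by simp
qed

lemma inf_imp_comm:
  "\<lbrakk>x \<in> carrier A; y \<in> carrier A\<rbrakk> \<Longrightarrow> inf_imp x y = inf_imp y x"
  using qi2[of x y \<zero>] by (simp add: inf_imp_def compl_def)

lemma inf_imp_below1: "\<lbrakk>x \<in> carrier A; y \<in> carrier A\<rbrakk> \<Longrightarrow> inf_imp x y \<preceq> x"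
  by (simp add: inf_imp_def compl_below_iff[of "_ \<cdot> _"] below_imp_self compl_below_imp)

lemma inf_imp_below2: "\<lbrakk>x \<in> carrier A; y \<in> carrier A\<rbrakk> \<Longrightarrow> inf_imp x y \<preceq> y"
  using inf_imp_below1[of y x] by (simp add: inf_imp_comm)

text \<open>Replacing \<open>y\<close> by the smaller \<open>z\<close> in
  \<open>(x \<cdot> y) \<cdot> compl x\<close> enlarges the term and turns it into
  \<open>compl z\<close>.\<close>

lemma inf_imp_greatest:
  assumes "z \<preceq> x" "z \<preceq> y" and "x \<in> carrier A" "y \<in> carrier A" "z \<in> carrier A"
  shows "z \<preceq> inf_imp x y"
proof -
  have "(x \<cdot> y) \<cdot> compl x \<preceq> (x \<cdot> z) \<cdot> compl x"
    using assms by (intro imp_antimono compl_below_imp imp_mono) auto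
  also have "(x \<cdot> z) \<cdot> compl x = compl z" using assms by (simp add: compl_eq_imp)
  finally show ?thesis using assms by (simp add: inf_imp_def below_compl_iff[of z])
qed

text \<open>De Morgan form, through which the laws of \<open>sup_imp\<close> are inherited from
  those of \<open>inf_imp\<close>.\<close>

lemma sup_imp_eq: "\<lbrakk>x \<in> carrier A; y \<in> carrier A\<rbrakk> \<Longrightarrow>
    sup_imp x y = compl (inf_imp (compl x) (compl y))"
  by (simp add: sup_imp_def inf_imp_def)

lemma sup_imp_comm: "\<lbrakk>x \<in> carrier A; y \<in> carrier A\<rbrakk> \<Longrightarrow> sup_imp x y = sup_imp y x"
  by (simp add: sup_imp_eq inf_imp_comm)

lemma below_sup_imp1: "\<lbrakk>x \<in> carrier A; y \<in> carrier A\<rbrakk> \<Longrightarrow> x \<preceq> sup_imp x y"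
  by (simp add: sup_imp_eq below_compl_iff[of x] inf_imp_below1)

lemma below_sup_imp2: "\<lbrakk>x \<in> carrier A; y \<in> carrier A\<rbrakk> \<Longrightarrow> y \<preceq> sup_imp x y"
  by (simp add: sup_imp_eq below_compl_iff[of y] inf_imp_below2)

lemma sup_imp_least:
  "\<lbrakk>x \<preceq> z; y \<preceq> z; x \<in> carrier A; y \<in> carrier A; z \<in> carrier A\<rbrakk> \<Longrightarrow> sup_imp x y \<preceq> z"
  by (simp add: sup_imp_eq compl_below_iff[of _ z] inf_imp_greatest compl_antimono)

lemma inf_imp_absorb: "\<lbrakk>x \<in> carrier A; y \<in> carrier A\<rbrakk> \<Longrightarrow> inf_imp x y = x \<longleftrightarrow> x \<preceq> y"
  by (metis below_antisym below_refl inf_imp_below1 inf_imp_below2 inf_imp_closed inf_imp_greatest)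

lemma inf_imp_compl: "x \<in> carrier A \<Longrightarrow> inf_imp x (compl x) = \<zero>"
  by (simp add: inf_imp_def imp_self) (simp add: compl_def imp_self)

lemma sup_imp_compl: "x \<in> carrier A \<Longrightarrow> sup_imp x (compl x) = \<one>"
  by (simp add: sup_imp_eq inf_imp_comm[of _ x] inf_imp_compl) (simp add: compl_def imp_self)

section \<open>Orthomodularity, and the product as a join\<close>

lemma imp_imp_below: "\<lbrakk>x \<preceq> y; x \<in> carrier A; y \<in> carrier A\<rbrakk> \<Longrightarrow> (y \<cdot> x) \<cdot> x = y"
  using qi3[of x y] by (simp add: below_def)

lemma compl_inf_imp_compl:
  "\<lbrakk>x \<in> carrier A; y \<in> carrier A\<rbrakk> \<Longrightarrow> compl (inf_imp x y) \<cdot> compl x = x \<cdot> y"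
  using imp_imp_below[of "compl x" "x \<cdot> y"] by (simp add: inf_imp_def compl_below_imp)

text \<open>Contraposition for comparable elements: here \<open>inf_imp x y\<close> is
  \<open>y\<close> in \<open>compl_inf_imp_compl\<close>.\<close>

lemma compl_imp_compl:
  assumes "y \<preceq> x" "x \<in> carrier A" "y \<in> carrier A"
  shows "compl y \<cdot> compl x = x \<cdot> y"
proof -
  have "inf_imp x y = y" using assms by (simp add: inf_imp_comm[of x y] inf_imp_absorb)
  then show ?thesis using compl_inf_imp_compl[of x y] assms by simp
qed

text \<open>This is the orthomodular law: in an orthomodular lattice \<open>x\<^sup>\<bottom> \<cdot> y = x \<or> (x\<^sup>\<bottom> \<and> y)\<close>.\<close>

lemma compl_imp_below:
  assumes "x \<preceq> y" "x \<in> carrier A" "y \<in> carrier A"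
  shows "compl x \<cdot> y = y"
proof -
  \<comment> \<open>Contraposition of \<open>x \<preceq> y \<cdot> x\<close> exhibits
    \<open>y\<close> as a product with left factor \<open>compl x\<close>; \<open>imp_imp\<close>
    says that such a product is fixed by multiplying with \<open>compl x\<close> again.\<close>
  have "compl x \<cdot> compl (y \<cdot> x) = y"
    using assms by (simp add: compl_imp_compl[of x "y \<cdot> x"] below_imp_self imp_imp_below)
  then show ?thesis using imp_imp[of "compl x" "compl (y \<cdot> x)"] assms by simp
qed

text \<open>Makes \<open>x \<cdot> y\<close> the join of \<open>compl x\<close> and \<open>y\<close>
  when \<open>y \<preceq> x\<close>. The bound \<open>z\<close> equals
  \<open>(z \<cdot> y) \<cdot> y\<close>, so it suffices to show
  \<open>z \<cdot> y \<preceq> x\<close>, which contraposition provides.\<close>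

lemma imp_least:
  assumes "y \<preceq> x" "compl x \<preceq> z" "y \<preceq> z"
    and carr: "x \<in> carrier A" "y \<in> carrier A" "z \<in> carrier A"
  shows "x \<cdot> y \<preceq> z"
proof -
  have "z \<cdot> y = compl y \<cdot> compl z" using assms by (simp add: compl_imp_compl)
  also have "\<dots> \<preceq> compl y \<cdot> x"
    using assms by (intro imp_mono) (auto simp: compl_below_iff[of z])
  also have "compl y \<cdot> x = x" using assms by (simp add: compl_imp_below)
  finally have "x \<cdot> y \<preceq> (z \<cdot> y) \<cdot> y"
    using assms by (intro imp_antimono below_imp_self) auto
  then show ?thesis using assms by (simp add: imp_imp_below)
qed

text \<open>Two contrapositions replace \<open>y\<close> by its meet with \<open>x\<close>; the
  product is then a least upper bound by \<open>imp_least\<close>. This recovers the product from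
  the lattice operations.\<close>

lemma imp_eq_sup:
  assumes x: "x \<in> carrier A" and y: "y \<in> carrier A"
  shows "x \<cdot> y = sup_imp (compl x) (inf_imp x y)"
proof -
  let ?c = "inf_imp x y"
  have eq: "x \<cdot> y = x \<cdot> ?c"
    using x y compl_inf_imp_compl[of x y] compl_imp_compl[of ?c x] by (simp add: inf_imp_below1)
  have "x \<cdot> ?c = sup_imp (compl x) ?c"
  proof (rule below_antisym)
    show "x \<cdot> ?c \<preceq> sup_imp (compl x) ?c"
      using x y by (intro imp_least inf_imp_below1 below_sup_imp1 below_sup_imp2) auto
    show "sup_imp (compl x) ?c \<preceq> x \<cdot> ?c"
      using x y by (intro sup_imp_least compl_below_imp below_imp_self inf_imp_below1) auto
  qed (use x y in auto)
  with eq show ?thesis by simp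
qed

lemma inf_imp_assoc:
  assumes "x \<in> carrier A" "y \<in> carrier A" "z \<in> carrier A"
  shows "inf_imp (inf_imp x y) z = inf_imp x (inf_imp y z)"
proof (rule below_antisym)
  show "inf_imp (inf_imp x y) z \<preceq> inf_imp x (inf_imp y z)"
    by (intro inf_imp_greatest; (rule below_trans[OF inf_imp_below1] inf_imp_below2)?)
      (auto simp: assms inf_imp_below1 inf_imp_below2)
  show "inf_imp x (inf_imp y z) \<preceq> inf_imp (inf_imp x y) z"
    by (intro inf_imp_greatest; (rule inf_imp_below1 below_trans[OF inf_imp_below2])?)
      (auto simp: assms inf_imp_below1 inf_imp_below2)
qed (use assms in auto)

lemma sup_imp_assoc:
  assumes "x \<in> carrier A" "y \<in> carrier A" "z \<in> carrier A"
  shows "sup_imp (sup_imp x y) z = sup_imp x (sup_imp y z)"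
  using assms by (simp add: sup_imp_eq inf_imp_assoc)

lemma inf_sup_absorb: "\<lbrakk>x \<in> carrier A; y \<in> carrier A\<rbrakk> \<Longrightarrow> inf_imp x (sup_imp x y) = x"
  by (simp add: inf_imp_absorb below_sup_imp1)

lemma sup_inf_absorb:
  assumes "x \<in> carrier A" "y \<in> carrier A"
  shows "sup_imp x (inf_imp x y) = x"
  using inf_sup_absorb[of "compl x" "compl y"] assms by (simp add: sup_imp_eq)

end

section \<open>Passing between the two signatures\<close>

definition mqia_of_qma :: "'a qma \<Rightarrow> 'a mqia" where
  "mqia_of_qma Q =
    \<lparr>carrier = carrier Q,
     imp = (\<lambda>x\<in>carrier Q. \<lambda>y\<in>carrier Q. oc\<^bsub>Q\<^esub> x \<squnion>\<^bsub>Q\<^esub> (x \<sqinter>\<^bsub>Q\<^esub> y)),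
     zero = \<bottom>\<^bsub>Q\<^esub>,
     diamond = quant Q\<rparr>"

text \<open>Meet and join are \<open>inf_imp\<close> and \<open>sup_imp\<close> written out, and top
  is the explicit product \<open>\<zero> \<cdot> \<zero>\<close>. Restriction to the carrier keeps
  the operations extensional, so that round trips can be equalities of records.\<close>

definition qma_of_mqia :: "'a mqia \<Rightarrow> 'a qma" where
  "qma_of_mqia A =
    \<lparr>carrier = carrier A,
     meet = (\<lambda>x\<in>carrier A. \<lambda>y\<in>carrier A. ((x \<cdot>\<^bsub>A\<^esub> y) \<cdot>\<^bsub>A\<^esub> (x \<cdot>\<^bsub>A\<^esub> \<zero>\<^bsub>A\<^esub>)) \<cdot>\<^bsub>A\<^esub> \<zero>\<^bsub>A\<^esub>),
     join = (\<lambda>x\<in>carrier A. \<lambda>y\<in>carrier A. ((x \<cdot>\<^bsub>A\<^esub> \<zero>\<^bsub>A\<^esub>) \<cdot>\<^bsub>A\<^esub> (y \<cdot>\<^bsub>A\<^esub> \<zero>\<^bsub>A\<^esub>)) \<cdot>\<^bsub>A\<^esub> x),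
     bottom = \<zero>\<^bsub>A\<^esub>,
     top_el = \<zero>\<^bsub>A\<^esub> \<cdot>\<^bsub>A\<^esub> \<zero>\<^bsub>A\<^esub>,
     ocompl = (\<lambda>x\<in>carrier A. x \<cdot>\<^bsub>A\<^esub> \<zero>\<^bsub>A\<^esub>),
     quant = diamond A\<rparr>"

lemma restrict_restrict_PiE:
  assumes "f \<in> S \<rightarrow>\<^sub>E T \<rightarrow>\<^sub>E U"
  shows "(\<lambda>x\<in>S. \<lambda>y\<in>T. f x y) = f"
proof
  show "(\<lambda>x\<in>S. \<lambda>y\<in>T. f x y) x = f x" for x
    using PiE_restrict[OF PiE_mem[OF assms, of x]] PiE_arb[OF assms, of x] by (cases "x \<in> S") auto
qed

lemma carrier_mqia_of_qma [simp]: "carrier (mqia_of_qma Q) = carrier Q"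
  by (simp add: mqia_of_qma_def)

lemma carrier_qma_of_mqia [simp]: "carrier (qma_of_mqia A) = carrier A"
  by (simp add: qma_of_mqia_def)

section \<open>From quantum monadic algebras to monadic quasi-implication algebras\<close>

context quantum_monadic_algebra
begin

lemma quant_in_carrier [simp]: "x \<in> carrier Q \<Longrightarrow> ex x \<in> carrier Q"
  using quant_closed by (meson PiE_mem)

lemma mqia_of_qma_simps [simp]:
  "\<lbrakk>x \<in> carrier Q; y \<in> carrier Q\<rbrakk> \<Longrightarrow> x \<cdot>\<^bsub>mqia_of_qma Q\<^esub> y = sasaki x y"
  "\<zero>\<^bsub>mqia_of_qma Q\<^esub> = \<bottom>"
  "diamond (mqia_of_qma Q) = quant Q"
  by (simp_all add: mqia_of_qma_def sasaki_def)

text \<open>Proved before the remaining axioms because those mention \<open>\<one>\<close>, whose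
  value is computed from this structure.\<close>

lemma quasi_implication_mqia_of_qma: "quasi_implication_algebra (mqia_of_qma Q)"
proof
  show "imp (mqia_of_qma Q) \<in> carrier (mqia_of_qma Q) \<rightarrow>\<^sub>E
      carrier (mqia_of_qma Q) \<rightarrow>\<^sub>E carrier (mqia_of_qma Q)"
    by (auto simp: mqia_of_qma_def)
qed (simp_all add: sasaki_1 sasaki_2_meet sasaki_3_join meet_comm join_comm)

lemma one_mqia_of_qma: "\<one>\<^bsub>mqia_of_qma Q\<^esub> = \<top>"
  using quasi_implication_algebra.imp_self[OF quasi_implication_mqia_of_qma, of \<bottom>]
  by (simp add: sasaki_self)

lemma monadic_mqia_of_qma: "monadic_quasi_implication_algebra (mqia_of_qma Q)"
proof -
  interpret quasi_implication_algebra "mqia_of_qma Q"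
    by (rule quasi_implication_mqia_of_qma)
  show ?thesis
    by unfold_locales
      (use quant_closed in \<open>simp_all add: one_mqia_of_qma bottom_sasaki sasaki_self quant_quant
        sasaki_eq_top quant_increasing sasaki_bottom quant_ocompl_quant quant_bottom
        sasaki_join quant_join\<close>)
qed

lemma qma_of_mqia_of_qma: "qma_of_mqia (mqia_of_qma Q) = Q"
proof (rule qma.equality)
  show "meet (qma_of_mqia (mqia_of_qma Q)) = meet Q"
  proof -
    have "meet (qma_of_mqia (mqia_of_qma Q)) = (\<lambda>x\<in>carrier Q. \<lambda>y\<in>carrier Q. x \<sqinter> y)"
      by (auto simp: qma_of_mqia_def sasaki_bottom sasaki_meet restrict_def fun_eq_iff)
    also have "\<dots> = meet Q"
      by (rule restrict_restrict_PiE[OF meet_closed])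
    finally show ?thesis .
  qed
  show "join (qma_of_mqia (mqia_of_qma Q)) = join Q"
  proof -
    have "join (qma_of_mqia (mqia_of_qma Q)) = (\<lambda>x\<in>carrier Q. \<lambda>y\<in>carrier Q. x \<squnion> y)"
      by (auto simp: qma_of_mqia_def sasaki_bottom sasaki_join restrict_def fun_eq_iff)
    also have "\<dots> = join Q"
      by (rule restrict_restrict_PiE[OF join_closed])
    finally show ?thesis .
  qed
  show "ocompl (qma_of_mqia (mqia_of_qma Q)) = ocompl Q"
    by (rule PiE_ext[OF _ ocompl_closed]) (auto simp: qma_of_mqia_def sasaki_bottom)
qed (simp_all add: qma_of_mqia_def sasaki_self)

end

section \<open>From monadic quasi-implication algebras to quantum monadic algebras\<close>

context monadic_quasi_implication_algebra
begin

lemma diamond_in_carrier [simp]: "x \<in> carrier A \<Longrightarrow> \<diamond> x \<in> carrier A"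
  using diamond_closed by (meson PiE_mem)

lemma qma_of_mqia_simps [simp]:
  "\<lbrakk>x \<in> carrier A; y \<in> carrier A\<rbrakk> \<Longrightarrow> x \<sqinter>\<^bsub>qma_of_mqia A\<^esub> y = inf_imp x y"
  "\<lbrakk>x \<in> carrier A; y \<in> carrier A\<rbrakk> \<Longrightarrow> x \<squnion>\<^bsub>qma_of_mqia A\<^esub> y = sup_imp x y"
  "x \<in> carrier A \<Longrightarrow> oc\<^bsub>qma_of_mqia A\<^esub> x = compl x"
  "\<bottom>\<^bsub>qma_of_mqia A\<^esub> = \<zero>"
  "\<top>\<^bsub>qma_of_mqia A\<^esub> = \<one>"
  "quant (qma_of_mqia A) = diamond A"
  by (simp_all add: qma_of_mqia_def inf_imp_def sup_imp_def compl_def imp_self)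

lemma lat_le_qma_of_mqia [simp]:
  "\<lbrakk>x \<in> carrier A; y \<in> carrier A\<rbrakk> \<Longrightarrow> x \<sqsubseteq>\<^bsub>qma_of_mqia A\<^esub> y \<longleftrightarrow> x \<preceq> y"
  by (simp add: lat_le_def inf_imp_absorb)

text \<open>The left side is \<open>compl x \<cdot> y\<close> by \<open>imp_eq_sup\<close>, and
  \<open>compl_imp_below\<close> evaluates it.\<close>

lemma sup_imp_orthomodular:
  assumes "x \<in> carrier A" "y \<in> carrier A" "x \<preceq> y"
  shows "sup_imp x (inf_imp (compl x) y) = y"
  using imp_eq_sup[of "compl x" y] assms by (simp add: compl_imp_below)

lemma diamond_idem: "x \<in> carrier A \<Longrightarrow> \<diamond> (\<diamond> x) = \<diamond> x"
  using diamond_diamond[of x] diamond_increasing[of "\<diamond> x"]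
  by (intro below_antisym) (auto simp: below_def)

lemma quantum_monadic_qma_of_mqia: "quantum_monadic_algebra (qma_of_mqia A)"
proof
  show "meet (qma_of_mqia A) \<in> carrier (qma_of_mqia A) \<rightarrow>\<^sub>E
      carrier (qma_of_mqia A) \<rightarrow>\<^sub>E carrier (qma_of_mqia A)"
    "join (qma_of_mqia A) \<in> carrier (qma_of_mqia A) \<rightarrow>\<^sub>E
      carrier (qma_of_mqia A) \<rightarrow>\<^sub>E carrier (qma_of_mqia A)"
    "ocompl (qma_of_mqia A) \<in> carrier (qma_of_mqia A) \<rightarrow>\<^sub>E carrier (qma_of_mqia A)"
    by (auto simp: qma_of_mqia_def)
  show "quant (qma_of_mqia A) \<in> carrier (qma_of_mqia A) \<rightarrow>\<^sub>E carrier (qma_of_mqia A)"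
    using diamond_closed by simp
  fix x y assume "x \<in> carrier (qma_of_mqia A)" "y \<in> carrier (qma_of_mqia A)"
  then show "ex\<^bsub>qma_of_mqia A\<^esub> (x \<squnion>\<^bsub>qma_of_mqia A\<^esub> y) =
      (ex\<^bsub>qma_of_mqia A\<^esub> x) \<squnion>\<^bsub>qma_of_mqia A\<^esub> (ex\<^bsub>qma_of_mqia A\<^esub> y)"
    using diamond_join[of x y] by (simp add: sup_imp_def compl_def)
next
  fix x assume "x \<in> carrier (qma_of_mqia A)"
  then show "ex\<^bsub>qma_of_mqia A\<^esub> (oc\<^bsub>qma_of_mqia A\<^esub> (ex\<^bsub>qma_of_mqia A\<^esub> x)) =
      oc\<^bsub>qma_of_mqia A\<^esub> (ex\<^bsub>qma_of_mqia A\<^esub> x)"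
    using diamond_compl[of x] by (simp add: compl_def)
next
  fix x assume "x \<in> carrier (qma_of_mqia A)"
  then show "x \<sqsubseteq>\<^bsub>qma_of_mqia A\<^esub> (ex\<^bsub>qma_of_mqia A\<^esub> x)"
    using diamond_increasing[of x] by (simp add: below_def)
qed (simp_all add: inf_imp_assoc sup_imp_assoc inf_sup_absorb
    sup_inf_absorb inf_imp_absorb inf_imp_compl sup_imp_compl compl_antimono
    sup_imp_orthomodular diamond_zero diamond_idem,
    simp_all add: inf_imp_comm sup_imp_comm)

lemma mqia_of_qma_of_mqia: "mqia_of_qma (qma_of_mqia A) = A"
proof (rule mqia.equality)
  have "imp (mqia_of_qma (qma_of_mqia A)) = (\<lambda>x\<in>carrier A. \<lambda>y\<in>carrier A. x \<cdot> y)"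
    by (auto simp: mqia_of_qma_def imp_eq_sup restrict_def fun_eq_iff)
  also have "\<dots> = imp A"
    by (rule restrict_restrict_PiE[OF imp_closed])
  finally show "imp (mqia_of_qma (qma_of_mqia A)) = imp A" .
qed (simp_all add: mqia_of_qma_def)

end

text \<open>Each signature consists of terms in the other, so the same maps preserve both. Equality
  of the hom-sets lets the functors leave underlying maps unchanged.\<close>

lemma mqia_hom_mqia_of_qma:
  assumes "quantum_monadic_algebra Q" and "quantum_monadic_algebra R"
  shows "mqia_hom (mqia_of_qma Q) (mqia_of_qma R) = qma_hom Q R"
proof -
  interpret Q: quantum_monadic_algebra Q by fact
  interpret R: quantum_monadic_algebra R by fact
  show ?thesis
  proof (intro subset_antisym subsetI)
    fix h assume h: "h \<in> mqia_hom (mqia_of_qma Q) (mqia_of_qma R)"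
    then have hc: "h \<in> carrier Q \<rightarrow>\<^sub>E carrier R"
      by (simp add: mqia_hom_def)
    have mem [simp]: "\<And>x. x \<in> carrier Q \<Longrightarrow> h x \<in> carrier R"
      using hc by auto
    have imp: "\<And>x y. \<lbrakk>x \<in> carrier Q; y \<in> carrier Q\<rbrakk>
        \<Longrightarrow> h (Q.sasaki x y) = R.sasaki (h x) (h y)"
      and bot: "h \<bottom>\<^bsub>Q\<^esub> = \<bottom>\<^bsub>R\<^esub>"
      and quant: "\<And>x. x \<in> carrier Q \<Longrightarrow> h (ex\<^bsub>Q\<^esub> x) = ex\<^bsub>R\<^esub> (h x)"
      using h by (simp_all add: mqia_hom_def)
    have oc: "h (oc\<^bsub>Q\<^esub> x) = oc\<^bsub>R\<^esub> (h x)" if "x \<in> carrier Q" for x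
      using imp[of x "\<bottom>\<^bsub>Q\<^esub>"] that by (simp add: Q.sasaki_bottom R.sasaki_bottom bot)
    have "h \<top>\<^bsub>Q\<^esub> = \<top>\<^bsub>R\<^esub>"
      using imp[of "\<bottom>\<^bsub>Q\<^esub>" "\<bottom>\<^bsub>Q\<^esub>"] by (simp add: Q.sasaki_self R.sasaki_self bot)
    moreover have "h (x \<sqinter>\<^bsub>Q\<^esub> y) = h x \<sqinter>\<^bsub>R\<^esub> h y" if "x \<in> carrier Q" "y \<in> carrier Q" for x y
      using that by (simp add: imp oc R.sasaki_meet flip: Q.sasaki_meet)
    moreover have "h (x \<squnion>\<^bsub>Q\<^esub> y) = h x \<squnion>\<^bsub>R\<^esub> h y" if "x \<in> carrier Q" "y \<in> carrier Q" for x y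
      using that by (simp add: imp oc R.sasaki_join flip: Q.sasaki_join)
    ultimately show "h \<in> qma_hom Q R"
      using hc bot oc quant by (simp add: qma_hom_def)
  next
    fix h assume h: "h \<in> qma_hom Q R"
    then have "\<And>x. x \<in> carrier Q \<Longrightarrow> h x \<in> carrier R"
      by (auto simp: qma_hom_def)
    with h show "h \<in> mqia_hom (mqia_of_qma Q) (mqia_of_qma R)"
      by (simp add: qma_hom_def mqia_hom_def Q.sasaki_def R.sasaki_def)
  qed
qed

section \<open>Categories of structured sets\<close>

lemma category_structured_sets:
  assumes carrier: "\<And>A B h. \<lbrakk>A \<in> \<O>; B \<in> \<O>; h \<in> H A B\<rbrakk> \<Longrightarrow> h \<in> carrier A \<rightarrow>\<^sub>E carrier B"
    and id: "\<And>A. A \<in> \<O> \<Longrightarrow> (\<lambda>x\<in>carrier A. x) \<in> H A A"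
    and comp: "\<And>A B C f g. \<lbrakk>A \<in> \<O>; B \<in> \<O>; C \<in> \<O>; f \<in> H A B; g \<in> H B C\<rbrakk>
      \<Longrightarrow> compose (carrier A) g f \<in> H A C"
  shows "category (structured_sets \<O> H)"
proof
  fix f assume "f \<in> Arr (structured_sets \<O> H)"
  then obtain A h B where f: "f = (A, h, B)" "A \<in> \<O>" "B \<in> \<O>" "h \<in> H A B"
    by (auto simp: structured_sets_def)
  then have h: "h \<in> carrier A \<rightarrow>\<^sub>E carrier B" by (simp add: carrier)
  then show "Comp (structured_sets \<O> H) f (Id (structured_sets \<O> H)
      (Dom (structured_sets \<O> H) f)) = f"
    using f by (auto simp: structured_sets_def compose_Id PiE_def)
  show "Comp (structured_sets \<O> H) (Id (structured_sets \<O> H)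
      (Cod (structured_sets \<O> H) f)) f = f"
    using f h by (auto simp: structured_sets_def Id_compose PiE_def)
next
  fix f g h
  assume "f \<in> Arr (structured_sets \<O> H)" "g \<in> Arr (structured_sets \<O> H)"
    "h \<in> Arr (structured_sets \<O> H)"
    "Cod (structured_sets \<O> H) f = Dom (structured_sets \<O> H) g"
    "Cod (structured_sets \<O> H) g = Dom (structured_sets \<O> H) h"
  then show "Comp (structured_sets \<O> H) h (Comp (structured_sets \<O> H) g f) =
      Comp (structured_sets \<O> H) (Comp (structured_sets \<O> H) h g) f"
    using carrier by (fastforce simp: structured_sets_def PiE_def intro!: compose_assoc)
qed (auto simp: structured_sets_def id comp)

text \<open>Equal carriers matter because identities and composites are restricted to the carrier of
  the domain.\<close>

lemma functor_structured_sets: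
  assumes "category (structured_sets \<O> H)" and "category (structured_sets \<O>' H')"
    and F: "\<And>A. A \<in> \<O> \<Longrightarrow> F A \<in> \<O>'"
    and carrier: "\<And>A. A \<in> \<O> \<Longrightarrow> carrier (F A) = carrier A"
    and hom: "\<And>A B. \<lbrakk>A \<in> \<O>; B \<in> \<O>\<rbrakk> \<Longrightarrow> H' (F A) (F B) = H A B"
  shows "cat_functor (structured_sets \<O> H) (structured_sets \<O>' H') F (\<lambda>(A, h, B). (F A, h, F B))"
proof -
  interpret C: category "structured_sets \<O> H" by fact
  interpret D: category "structured_sets \<O>' H'" by fact
  show ?thesis
    by unfold_locales (auto simp: structured_sets_def F carrier hom)
qed

lemma isomorphic_structured_sets:
  assumes "category (structured_sets \<O> H)" and "category (structured_sets \<O>' H')"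
    and F: "\<And>A. A \<in> \<O> \<Longrightarrow> F A \<in> \<O>'" and G: "\<And>B. B \<in> \<O>' \<Longrightarrow> G B \<in> \<O>"
    and GF: "\<And>A. A \<in> \<O> \<Longrightarrow> G (F A) = A" and FG: "\<And>B. B \<in> \<O>' \<Longrightarrow> F (G B) = B"
    and carrier: "\<And>A. A \<in> \<O> \<Longrightarrow> carrier (F A) = carrier A"
    and hom: "\<And>A B. \<lbrakk>A \<in> \<O>; B \<in> \<O>\<rbrakk> \<Longrightarrow> H' (F A) (F B) = H A B"
  shows "isomorphic_categories (structured_sets \<O> H) (structured_sets \<O>' H')"
proof -
  \<comment> \<open>The conditions on \<open>G\<close> are those on \<open>F\<close> at objects of
    the form \<open>G B\<close>, since \<open>F (G B) = B\<close>.\<close>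
  have "carrier (G B) = carrier B" if "B \<in> \<O>'" for B
    using carrier[OF G[OF that]] that by (simp add: FG)
  moreover have "H (G A) (G B) = H' A B" if "A \<in> \<O>'" "B \<in> \<O>'" for A B
    using hom[OF G G] that by (simp add: FG)
  ultimately have "cat_functor (structured_sets \<O>' H') (structured_sets \<O> H) G
      (\<lambda>(A, h, B). (G A, h, G B))"
    using assms by (intro functor_structured_sets) auto
  moreover have "cat_functor (structured_sets \<O> H) (structured_sets \<O>' H') F
      (\<lambda>(A, h, B). (F A, h, F B))"
    using assms by (intro functor_structured_sets) auto
  ultimately show ?thesis
    unfolding isomorphic_categories_def
    by (intro exI conjI) (auto simp: structured_sets_def GF FG)
qed

lemma category_QMA: "category QMA"
  unfolding QMA_def
proof (rule category_structured_sets)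
  fix A :: "'a qma" assume "A \<in> {A. quantum_monadic_algebra A}"
  then interpret quantum_monadic_algebra A by simp
  show "(\<lambda>x\<in>carrier A. x) \<in> qma_hom A A" by (simp add: qma_hom_def)
next
  fix A B C :: "'a qma" and f g :: "'a \<Rightarrow> 'a"
  assume "A \<in> {A. quantum_monadic_algebra A}" and f: "f \<in> qma_hom A B" and g: "g \<in> qma_hom B C"
  then interpret quantum_monadic_algebra A by simp
  have "\<And>x. x \<in> carrier A \<Longrightarrow> f x \<in> carrier B" "\<And>x. x \<in> carrier B \<Longrightarrow> g x \<in> carrier C"
    using f g by (auto simp: qma_hom_def)
  then show "compose (carrier A) g f \<in> qma_hom A C"
    using f g by (simp add: qma_hom_def compose_def)
qed (simp add: qma_hom_def)

lemma category_MQIA: "category MQIA"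
  unfolding MQIA_def
proof (rule category_structured_sets)
  fix A :: "'a mqia" assume "A \<in> {A. monadic_quasi_implication_algebra A}"
  then interpret monadic_quasi_implication_algebra A by simp
  show "(\<lambda>x\<in>carrier A. x) \<in> mqia_hom A A" by (simp add: mqia_hom_def)
next
  fix A B C :: "'a mqia" and f g :: "'a \<Rightarrow> 'a"
  assume "A \<in> {A. monadic_quasi_implication_algebra A}"
    and f: "f \<in> mqia_hom A B" and g: "g \<in> mqia_hom B C"
  then interpret monadic_quasi_implication_algebra A by simp
  have "\<And>x. x \<in> carrier A \<Longrightarrow> f x \<in> carrier B" "\<And>x. x \<in> carrier B \<Longrightarrow> g x \<in> carrier C"
    using f g by (auto simp: mqia_hom_def)
  then show "compose (carrier A) g f \<in> mqia_hom A C"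
    using f g by (simp add: mqia_hom_def compose_def)
qed (simp add: mqia_hom_def)

theorem theorem4p10:
  shows "isomorphic_categories
    (QMA :: ('a qma, 'a qma \<times> ('a \<Rightarrow> 'a) \<times> 'a qma) category)
    (MQIA :: ('a mqia, 'a mqia \<times> ('a \<Rightarrow> 'a) \<times> 'a mqia) category)"
  unfolding QMA_def MQIA_def
  by (rule isomorphic_structured_sets[where F = mqia_of_qma and G = qma_of_mqia])
    (simp_all add: category_QMA[unfolded QMA_def] category_MQIA[unfolded MQIA_def]
      quantum_monadic_algebra.monadic_mqia_of_qma
      monadic_quasi_implication_algebra.quantum_monadic_qma_of_mqia
      quantum_monadic_algebra.qma_of_mqia_of_qma
      monadic_quasi_implication_algebra.mqia_of_qma_of_mqia
      mqia_hom_mqia_of_qma)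

end
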